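(* Let $p$ be a prime number and let $G$ be a semi-extraspecial $p$-group with $|G:Z(G)| = p^{2a}$. For every $p'$-automorphism $\varphi$ of $G$, we have $\mathrm{ord}(\varphi) \leq p^{2a}-1$. Moreover, $\mathrm{ord}(\varphi) = p^{2a}-1$ if and only if $\varphi$ permutes the nontrivial cosets of $Z(G)$ in $G$ transitively.
   Context: All groups are finite. $G'$ denotes the derived subgroup of $G$ and $Z(G)$ its center. A $p$-group $E$ is called extraspecial if $|E'| = |Z(E)| = p$. A nontrivial $p$-group $G$ is called semi-extraspecial if $G/N$ is extraspecial for every maximal subgroup $N$ of $Z(G)$. It is known that for a semi-extraspecial $p$-group $G$ one has $G' = Z(G) = \Phi(G)$ (the Frattini subgroup), and that $|G:Z(G)| = p^{2a}$ for some positive integer $a$. A $p'$-automorphism of $G$ is an automorphism of $G$ whose order is not divisible by $p$; $\mathrm{ord}(\varphi)$ denotes the order of $\varphi$. That $\varphi$ permutes the nontrivial cosets transitively means that the cyclic group $\langle\varphi\rangle$ acts transitively on the set of nontrivial elements of $G/Z(G)$. *)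

theory Defs
  imports "HOL-Algebra.Algebra"
begin

definition center :: "('a, 'b) monoid_scheme \<Rightarrow> 'a set" where
  "center G = {z \<in> carrier G. \<forall>g \<in> carrier G. z \<otimes>\<^bsub>G\<^esub> g = g \<otimes>\<^bsub>G\<^esub> z}"

definition maximal_subgroup :: "'a set \<Rightarrow> ('a, 'b) monoid_scheme \<Rightarrow> bool" where
  "maximal_subgroup M G \<longleftrightarrow>
     subgroup M G \<and> M \<noteq> carrier G \<and>
     (\<forall>H. subgroup H G \<longrightarrow> M \<subseteq> H \<longrightarrow> H = M \<or> H = carrier G)"

definition p_group :: "nat \<Rightarrow> ('a, 'b) monoid_scheme \<Rightarrow> bool" where
  "p_group p G \<longleftrightarrow> group G \<and> finite (carrier G) \<and> (\<exists>n. order G = p ^ n)"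

definition extraspecial :: "nat \<Rightarrow> ('a, 'b) monoid_scheme \<Rightarrow> bool" where
  "extraspecial p E \<longleftrightarrow>
     p_group p E \<and> card (derived E (carrier E)) = p \<and> card (center E) = p"

text \<open>The quotient \<open>G Mod N\<close> makes sense because every subgroup of the center is normal.\<close>

definition semi_extraspecial :: "nat \<Rightarrow> ('a, 'b) monoid_scheme \<Rightarrow> bool" where
  "semi_extraspecial p G \<longleftrightarrow>
     p_group p G \<and> carrier G \<noteq> {\<one>\<^bsub>G\<^esub>} \<and>
     (\<forall>N. maximal_subgroup N (G\<lparr>carrier := center G\<rparr>) \<longrightarrow> extraspecial p (G Mod N))"

text \<open>
  The library's automorphisms (\<open>auto G\<close>) are extensional, i.e. undefined outside \<open>carrier G\<close>,
  so that each automorphism is represented by exactly one function.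
\<close>

definition p'_automorphism :: "nat \<Rightarrow> ('a, 'b) monoid_scheme \<Rightarrow> ('a \<Rightarrow> 'a) \<Rightarrow> bool" where
  "p'_automorphism p G \<phi> \<longleftrightarrow> \<phi> \<in> auto G \<and> \<not> p dvd group.ord (AutoGroup G) \<phi>"

definition nontrivial_central_cosets :: "('a, 'b) monoid_scheme \<Rightarrow> 'a set set" where
  "nontrivial_central_cosets G =
     carrier (G Mod center G) - {\<one>\<^bsub>G Mod center G\<^esub>}"

text \<open>
  An automorphism \<open>\<psi>\<close> of \<open>G\<close> sends the coset \<open>Zx\<close> to its image \<open>\<psi> ` (Zx) = Z\<psi>(x)\<close>, where \<open>Z\<close> is
  the center. This is always an action on the nontrivial cosets, because the center is
  characteristic; the only condition imposed below is therefore transitivity.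
\<close>

definition permutes_cosets_transitively :: "('a, 'b) monoid_scheme \<Rightarrow> ('a \<Rightarrow> 'a) \<Rightarrow> bool" where
  "permutes_cosets_transitively G \<phi> \<longleftrightarrow>
     transitive_action (subgroup_generated (AutoGroup G) {\<phi>})
       (nontrivial_central_cosets G)
       (\<lambda>\<psi>. \<lambda>C \<in> nontrivial_central_cosets G. \<psi> ` C)"

end

theory Submission
  imports Defs
begin

text \<open>Write \<open>Z\<close> for the center of \<open>G\<close> and \<open>m\<close> for the order of \<open>\<phi>\<close>. The whole statement follows from the
  existence of a nontrivial coset \<open>C\<close> of \<open>Z\<close> that only the identity of \<open>\<langle>\<phi>\<rangle>\<close> maps to itself
  (\<open>p'_automorphism_regular_coset\<close>). Its orbit consists of exactly \<open>m\<close> of the \<open>p\<^bsup>2a\<^esup> - 1\<close> nontrivial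
  cosets, which gives the bound; equality holds precisely when this orbit contains every nontrivial coset,
  that is, when the action is transitive.

  Such a \<open>C\<close> exists for two reasons. First, \<open>\<langle>\<phi>\<rangle>\<close> acts faithfully on \<open>G/Z\<close>: in a semi-extraspecial
  group \<open>Z\<close> equals the derived subgroup \<open>G'\<close> (\<open>semi_extraspecial_derived_eq_center\<close>), an
  automorphism that is trivial on \<open>G/Z\<close> fixes all commutators, hence fixes \<open>Z\<close> pointwise, and then
  its powers multiply each element of \<open>G\<close> by powers of a fixed central element; this is
  impossible for a nontrivial automorphism of order prime to \<open>p\<close>
  (\<open>coprime_hom_trivial_mod_center\<close>). Second, a cyclic group of automorphisms, of order coprime to
  that of a finite abelian group, has a point whose stabilizer acts trivially on the whole
  group (\<open>exists_regular_orbit\<close>). This is proved with norm maps in place of linear algebra: if a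
  nontrivial automorphism \<open>b\<close> stabilizes \<open>v\<close>, the group splits into the fixed points of \<open>b\<close> and the
  kernel of the norm of \<open>b\<close>, and multiplying \<open>v\<close> by a nontrivial element of that kernel makes the
  stabilizer strictly smaller.\<close>

section \<open>Actions of p-groups\<close>

lemma group_actionI:
  fixes G (structure)
  assumes "group G"
    and ext: "\<And>g. g \<in> carrier G \<Longrightarrow> \<phi> g \<in> extensional E"
    and closed: "\<And>g x. \<lbrakk>g \<in> carrier G; x \<in> E\<rbrakk> \<Longrightarrow> \<phi> g x \<in> E"
    and one: "\<And>x. x \<in> E \<Longrightarrow> \<phi> \<one>\<^bsub>G\<^esub> x = x"
    and mult: "\<And>g h x. \<lbrakk>g \<in> carrier G; h \<in> carrier G; x \<in> E\<rbrakk> \<Longrightarrow>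
                 \<phi> (g \<otimes>\<^bsub>G\<^esub> h) x = \<phi> g (\<phi> h x)"
  shows "group_action G E \<phi>"
proof -
  interpret group G by fact
  have Bij: "\<phi> g \<in> Bij E" if g: "g \<in> carrier G" for g
  proof -
    have "bij_betw (\<phi> g) E E"
    proof (rule bij_betw_byWitness[where f' = "\<phi> (inv g)"])
      show "\<forall>x\<in>E. \<phi> (inv g) (\<phi> g x) = x"
        using g by (simp flip: mult add: one)
      show "\<forall>x\<in>E. \<phi> g (\<phi> (inv g) x) = x"
        using g by (simp flip: mult add: one)
    qed (use g closed in auto)
    then show ?thesis using ext[OF g] by (simp add: Bij_def)
  qed
  have "\<phi> \<in> hom G (BijGroup E)"
  proof (rule homI)
    show "\<phi> g \<in> carrier (BijGroup E)" if "g \<in> carrier G" for g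
      using Bij[OF that] by (simp add: BijGroup_def)
  next
    fix g h assume gh: "g \<in> carrier G" "h \<in> carrier G"
    have "\<phi> (g \<otimes> h) = compose E (\<phi> g) (\<phi> h)"
      by (rule extensionalityI[of _ E]) (use gh ext mult in \<open>auto simp: compose_eq\<close>)
    then show "\<phi> (g \<otimes> h) = \<phi> g \<otimes>\<^bsub>BijGroup E\<^esub> \<phi> h"
      using gh by (simp add: BijGroup_def Bij)
  qed
  then show ?thesis
    unfolding group_action_def
    by (intro group_hom.intro group_hom_axioms.intro) (simp_all add: group_BijGroup)
qed

text \<open>The orbits partition \<open>E\<close> and have \<open>p\<close>-power size, so \<open>p\<close> divides the size of every orbit that is
  not a single fixed point.\<close>

lemma (in group_action) prime_dvd_card_nonfixed:
  assumes p: "Factorial_Ring.prime (p::nat)" and "finite E" and ord: "order G = p ^ n"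
  shows "p dvd card {x \<in> E. \<exists>g\<in>carrier G. \<phi> g x \<noteq> x}" (is "p dvd card ?M")
proof -
  have "card ?M = (\<Sum>x\<in>E. if x \<in> ?M then 1 else 0)"
    using \<open>finite E\<close> by (subst sum.inter_restrict[symmetric]) (auto simp: Int_def)
  also have "\<dots> = (\<Sum>R\<in>orbits G E \<phi>. \<Sum>x\<in>R. if x \<in> ?M then 1 else 0)"
    by (rule disjoint_sum[OF \<open>finite E\<close>, symmetric])
  also have "p dvd \<dots>"
  proof (rule dvd_sum)
    fix R assume "R \<in> orbits G E \<phi>"
    then obtain x where x: "x \<in> E" and R: "R = orbit G \<phi> x"
      by (auto simp: orbits_def)
    have orb: "orbit G \<phi> y = R" if "y \<in> R" for y
    proof -
      have "y \<in> E" using that x unfolding R orbit_def by (auto intro: element_image)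
      moreover from this have "orbit G \<phi> y \<in> orbits G E \<phi>" by (auto simp: orbits_def)
      ultimately show ?thesis
        using disjoint_union[OF _ \<open>R \<in> orbits G E \<phi>\<close>] orbit_refl that by blast
    qed
    have "R \<subseteq> E" using x unfolding R orbit_def by (auto intro: element_image)
    have M_iff: "y \<in> ?M \<longleftrightarrow> R \<noteq> {y}" if y: "y \<in> R" for y
    proof -
      have "y \<in> E" using y \<open>R \<subseteq> E\<close> by auto
      then show ?thesis using orb[OF y] orbit_refl[of y] unfolding orbit_def by blast
    qed
    show "p dvd (\<Sum>x\<in>R. if x \<in> ?M then 1 else 0)"
    proof (cases "\<exists>y. R = {y}")
      case True
      then show ?thesis using M_iff by auto
    next
      case False
      then have "(\<Sum>x\<in>R. if x \<in> ?M then 1 else 0) = card R"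
        using M_iff by (simp cong: sum.cong)
      moreover have "card R dvd p ^ n"
        using orbit_stabilizer_theorem[OF x] ord unfolding R by (metis dvd_triv_left)
      moreover have "card R \<noteq> 1" using False by (auto simp: card_1_singleton_iff)
      ultimately show ?thesis
        using p by (auto simp: divides_primepow_nat) 
    qed
  qed
  finally show ?thesis .
qed

section \<open>Centers of semi-extraspecial groups\<close>

context group
begin

lemma center_subgroup: "subgroup (center G) G"
proof (rule subgroupI)
  show "inv a \<in> center G" if a: "a \<in> center G" for a
  proof -
    have "inv a \<otimes> g = g \<otimes> inv a" if g: "g \<in> carrier G" for g
      using a g unfolding center_def by simp (metis inv_closed inv_mult_group inv_inv)
    then show ?thesis using a by (auto simp: center_def)
  qed
  show "a \<otimes> b \<in> center G" if ab: "a \<in> center G" "b \<in> center G" for a b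
  proof -
    have c: "a \<in> carrier G" "b \<in> carrier G"
      and comm: "a \<otimes> g = g \<otimes> a" "b \<otimes> g = g \<otimes> b" if "g \<in> carrier G" for g
      using ab that by (auto simp: center_def)
    have "a \<otimes> b \<otimes> g = g \<otimes> (a \<otimes> b)" if g: "g \<in> carrier G" for g
    proof -
      have "a \<otimes> b \<otimes> g = a \<otimes> (g \<otimes> b)"
        using c[OF g] g by (simp add: m_assoc comm(2)[OF g])
      also have "\<dots> = (a \<otimes> g) \<otimes> b" using c[OF g] g by (simp add: m_assoc)
      also have "\<dots> = g \<otimes> (a \<otimes> b)" using c[OF g] g by (simp only: comm(1)[OF g] m_assoc)
      finally show ?thesis .
    qed
    then show ?thesis using c[OF one_closed] by (simp add: center_def)
  qed
qed (auto simp: center_def)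

lemma central_subgroup_normal:
  assumes "subgroup N G" "N \<subseteq> center G"
  shows "N \<lhd> G"
proof (rule normal_invI[OF assms(1)])
  fix h x assume hx: "h \<in> N" "x \<in> carrier G"
  then have "x \<otimes> h = h \<otimes> x" "h \<in> carrier G"
    using assms(2) by (auto simp: center_def)
  then show "x \<otimes> h \<otimes> inv x \<in> N"
    using hx by (simp add: m_assoc)
qed

text \<open>The elements of \<open>N\<close> that \<open>G\<close> fixes under conjugation are those of \<open>N \<inter> Z(G)\<close>. Their number is
  congruent to \<open>|N|\<close>, hence to \<open>0\<close>, modulo \<open>p\<close>, so \<open>\<one>\<close> is not the only one.\<close>

lemma nontrivial_normal_meets_center:
  assumes p: "Factorial_Ring.prime p" and ord: "order G = p ^ n"
    and N: "N \<lhd> G" and "N \<noteq> {\<one>}"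
  obtains z where "z \<in> N" "z \<in> center G" "z \<noteq> \<one>"
proof -
  interpret N: normal N G by fact
  have fin: "finite (carrier G)"
    using ord p order_gt_0_iff_finite prime_gt_0_nat by force
  then have finN: "finite N" using N.subset finite_subset by blast
  let ?c = "\<lambda>g. \<lambda>x\<in>N. g \<otimes> x \<otimes> inv g"
  interpret c: group_action G N ?c
  proof (rule group_actionI)
    show "?c g x \<in> N" if "g \<in> carrier G" "x \<in> N" for g x
      using that N.inv_op_closed2 by simp
    show "?c (g \<otimes> h) x = ?c g (?c h x)"
      if "g \<in> carrier G" "h \<in> carrier G" "x \<in> N" for g h x
      using that N.inv_op_closed2[of h x] N.subset
      by (auto simp: inv_mult_group m_assoc subset_iff)
  qed (use N.subset in \<open>auto simp: group_axioms\<close>)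
  let ?F = "N \<inter> center G" and ?M = "{x \<in> N. \<exists>g\<in>carrier G. ?c g x \<noteq> x}"
  have conj: "g \<otimes> x \<otimes> inv g = x \<longleftrightarrow> x \<otimes> g = g \<otimes> x"
    if "g \<in> carrier G" "x \<in> carrier G" for g x
    using that by (metis inv_solve_right m_closed)
  have F: "?F = N - ?M"
    using N.subset conj by (auto simp: center_def subset_iff)
  have "card N dvd p ^ n" using lagrange[OF N.subgroup_axioms] ord by (metis dvd_triv_right)
  moreover have "card N \<noteq> 1" using \<open>N \<noteq> {\<one>}\<close> N.one_closed by (metis card_1_singletonE singletonD)
  ultimately have "p dvd card N" using p by (auto simp: divides_primepow_nat)
  moreover have "p dvd card ?M"
    using c.prime_dvd_card_nonfixed[OF p finN ord] .
  moreover have "card ?F = card N - card ?M"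
    unfolding F by (rule card_Diff_subset) (use finN in auto)
  ultimately have "p dvd card ?F" by (simp add: dvd_diff_nat)
  then have "?F \<noteq> {\<one>}" using p prime_nat_iff by force
  moreover have "\<one> \<in> ?F" using N.one_closed center_subgroup subgroup.one_closed by auto
  ultimately show ?thesis using that by blast
qed

lemma subgroup_in_maximal_subgroup:
  assumes "finite (carrier G)" "subgroup H G" "H \<noteq> carrier G"
  obtains M where "maximal_subgroup M G" "H \<subseteq> M"
proof -
  let ?S = "{K. subgroup K G \<and> K \<noteq> carrier G \<and> H \<subseteq> K}"
  have "?S \<subseteq> Pow (carrier G)" using subgroup.subset by blast
  then have "finite ?S" using assms(1) finite_subset by blast
  moreover have "H \<in> ?S" using assms by blast
  ultimately obtain M where "M \<in> ?S" "\<forall>K\<in>?S. M \<subseteq> K \<longrightarrow> M = K"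
    using finite_has_maximal[of ?S] by auto
  then show ?thesis using that[of M] unfolding maximal_subgroup_def by blast
qed

lemma card_subgroup_dvd:
  assumes "subgroup H G" "subgroup K G" "H \<subseteq> K"
  shows "card H dvd card K"
proof -
  interpret K: group "G\<lparr>carrier := K\<rparr>" using assms(2) by (rule subgroup_imp_group)
  have "subgroup H (G\<lparr>carrier := K\<rparr>)" using assms subgroup_incl by blast
  from K.lagrange[OF this] have "card K = card H * card (rcosets\<^bsub>G\<lparr>carrier := K\<rparr>\<^esub> H)"
    by (simp add: order_def mult.commute)
  then show ?thesis by (rule dvdI)
qed

lemma prime_order_subgroups_eq:
  assumes "Factorial_Ring.prime p" "subgroup H G" "subgroup K G" "card H = p" "card K = p"
    and z: "z \<in> H" "z \<in> K" "z \<noteq> \<one>"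
  shows "H = K"
proof -
  have sub: "subgroup (H \<inter> K) G" using assms by (simp add: subgroups_Inter_pair)
  have eq: "H \<inter> K = L" if L: "subgroup L G" "card L = p" "H \<inter> K \<subseteq> L" for L
  proof -
    have "card (H \<inter> K) dvd p" using card_subgroup_dvd[OF sub L(1,3)] L(2) by simp
    moreover have "card (H \<inter> K) \<noteq> 1"
      using z subgroup.one_closed[OF sub] by (metis IntI card_1_singletonE singletonD)
    ultimately have "card (H \<inter> K) = card L" using assms(1) L(2) by (auto simp: prime_nat_iff)
    moreover have "finite L" using L(2) assms(1) card_ge_0_finite prime_gt_0_nat by blast
    ultimately show ?thesis using L(3) card_subset_eq by blast
  qed
  show ?thesis using eq[of H] eq[of K] assms by auto
qed

end

text \<open>The derived subgroup is normal and nontrivial, so it shares a nontrivial element with the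
  center, and both have prime order.\<close>

lemma extraspecial_derived_eq_center:
  assumes p: "Factorial_Ring.prime p" and E: "extraspecial p E"
  shows "derived E (carrier E) = center E"
proof -
  interpret group E using E by (simp add: extraspecial_def p_group_def)
  obtain n where n: "order E = p ^ n" using E by (auto simp: extraspecial_def p_group_def)
  have c: "card (derived E (carrier E)) = p" "card (center E) = p"
    using E by (auto simp: extraspecial_def)
  then have "derived E (carrier E) \<noteq> {\<one>\<^bsub>E\<^esub>}" using p by (auto simp: prime_nat_iff)
  from nontrivial_normal_meets_center[OF p n derived_self_is_normal this]
  show ?thesis
    using prime_order_subgroups_eq[OF p _ center_subgroup c] derived_is_subgroup by blast
qed

text \<open>In an extraspecial quotient \<open>G/N\<close> the nontrivial central subgroup \<open>Z/N\<close> must be the whole center of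
  \<open>G/N\<close>, because that has prime order. Hence \<open>G'N/N = Z/N\<close>, which gives \<open>G' \<subseteq> Z\<close>. If \<open>G'\<close> were smaller
  than \<open>Z\<close>, it would lie in some maximal subgroup \<open>N\<close> of \<open>Z\<close>, and then the extraspecial group \<open>G/N\<close>
  would be abelian.\<close>

lemma semi_extraspecial_derived_eq_center:
  fixes G (structure)
  assumes p: "Factorial_Ring.prime p" and G: "semi_extraspecial p G"
  shows "derived G (carrier G) = center G"
proof -
  interpret group G using G by (simp add: semi_extraspecial_def p_group_def)
  let ?Z = "center G" and ?D = "derived G (carrier G)"
  obtain n where n: "order G = p ^ n" and fin: "finite (carrier G)"
    using G by (auto simp: semi_extraspecial_def p_group_def)
  interpret Z: subgroup ?Z G by (rule center_subgroup)
  interpret GZ: group "G\<lparr>carrier := ?Z\<rparr>" using center_subgroup by (rule subgroup_imp_group)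
  have finZ: "finite ?Z" using fin Z.subset finite_subset by blast
  have D: "subgroup ?D G" using derived_is_subgroup by blast
  have Z_ne: "?Z \<noteq> {\<one>}"
    using nontrivial_normal_meets_center[OF p n normal_self] G
    by (auto simp: semi_extraspecial_def)
  have quot: "N \<lhd> G \<and> N \<subseteq> ?Z \<and> N \<noteq> ?Z \<and> extraspecial p (G Mod N)"
    if "maximal_subgroup N (G\<lparr>carrier := ?Z\<rparr>)" for N
  proof -
    have N: "subgroup N (G\<lparr>carrier := ?Z\<rparr>)" "N \<noteq> ?Z" "extraspecial p (G Mod N)"
      using that G by (auto simp: maximal_subgroup_def semi_extraspecial_def)
    then have "subgroup N G" "N \<subseteq> ?Z"
      using incl_subgroup[OF center_subgroup] subgroup.subset by fastforce+
    then show ?thesis using N central_subgroup_normal by blast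
  qed
  have derived_quot: "derived (G Mod N) (carrier (G Mod N)) = (\<lambda>x. N #> x) ` ?D" if "N \<lhd> G" for N
  proof -
    interpret N: normal N G by fact
    interpret q: group_hom G "G Mod N" "\<lambda>x. N #> x"
      using N.r_coset_hom_Mod N.factorgroup_is_group
      by (intro group_hom.intro group_hom_axioms.intro group_axioms)
    show ?thesis using q.derived_img[of "carrier G"] by (simp add: carrier_FactGroup)
  qed
  have "?D \<subseteq> ?Z"
  proof -
    obtain N where "maximal_subgroup N (G\<lparr>carrier := ?Z\<rparr>)"
      using GZ.subgroup_in_maximal_subgroup[OF _ GZ.triv_subgroup] finZ Z_ne by auto
    note quot[OF this]
    then have N: "N \<lhd> G" "N \<subseteq> ?Z" "N \<noteq> ?Z" and E: "extraspecial p (G Mod N)" by auto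
    interpret N: normal N G by fact
    interpret q: group_hom G "G Mod N" "\<lambda>x. N #> x"
      using N.r_coset_hom_Mod N.factorgroup_is_group
      by (intro group_hom.intro group_hom_axioms.intro group_axioms)
    let ?I = "(\<lambda>x. N #> x) ` ?Z"
    have cE: "card (center (G Mod N)) = p" using E by (auto simp: extraspecial_def)
    have I: "subgroup ?I (G Mod N)" using q.subgroup_img_is_subgroup[OF center_subgroup] .
    have I_sub: "?I \<subseteq> center (G Mod N)"
    proof clarify
      fix z assume z: "z \<in> ?Z"
      then have zG: "z \<in> carrier G" and comm: "\<And>g. g \<in> carrier G \<Longrightarrow> z \<otimes> g = g \<otimes> z"
        unfolding center_def by blast+
      have "(N #> z) \<otimes>\<^bsub>G Mod N\<^esub> Y = Y \<otimes>\<^bsub>G Mod N\<^esub> (N #> z)"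
        if Y: "Y \<in> carrier (G Mod N)" for Y
      proof -
        obtain g where g: "g \<in> carrier G" "Y = N #> g" using Y by (auto simp: carrier_FactGroup)
        show ?thesis
          by (simp only: g(2) mult_FactGroup N.rcos_sum[OF zG g(1)] N.rcos_sum[OF g(1) zG] comm[OF g(1)])
      qed
      then show "N #> z \<in> center (G Mod N)"
        using zG unfolding center_def carrier_FactGroup by blast
    qed
    obtain z where z: "z \<in> ?Z" "z \<notin> N" using N by blast
    have zN: "N #> z \<noteq> N" using z Z.subset rcos_self[OF _ N.subgroup_axioms] by blast
    have "card ?I dvd p"
      using q.H.card_subgroup_dvd[OF I q.H.center_subgroup I_sub] cE by simp
    moreover have "card ?I \<noteq> 1"
      using z(1) zN subgroup.one_closed[OF I] by (metis card_1_singletonE imageI one_FactGroup singletonD)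
    ultimately have "card ?I = card (center (G Mod N))"
      using p cE by (auto simp: prime_nat_iff)
    moreover have "finite (center (G Mod N))" using cE p card_ge_0_finite prime_gt_0_nat by blast
    ultimately have "?I = center (G Mod N)" using I_sub card_subset_eq by blast
    then have eq: "(\<lambda>x. N #> x) ` ?D = ?I"
      using derived_quot[OF N(1)] extraspecial_derived_eq_center[OF p E] by simp
    show ?thesis
    proof
      fix d assume d: "d \<in> ?D"
      then have dG: "d \<in> carrier G" using D subgroup.subset by blast
      obtain z where z: "z \<in> ?Z" "N #> d = N #> z" using eq d by blast
      then have "d \<in> N #> z" using rcos_self[OF dG N.subgroup_axioms] by simp
      then show "d \<in> ?Z" using z N by (auto simp: r_coset_def)
    qed
  qed
  moreover have "?D = ?Z"
  proof (rule ccontr)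
    assume "?D \<noteq> ?Z"
    moreover have "subgroup ?D (G\<lparr>carrier := ?Z\<rparr>)"
      using D \<open>?D \<subseteq> ?Z\<close> center_subgroup subgroup_incl by blast
    ultimately obtain N where "maximal_subgroup N (G\<lparr>carrier := ?Z\<rparr>)" and DN: "?D \<subseteq> N"
      using GZ.subgroup_in_maximal_subgroup[of ?D] finZ by auto
    note quot[OF this(1)]
    then have N: "N \<lhd> G" and E: "extraspecial p (G Mod N)" by auto
    interpret N: normal N G by fact
    have "(\<lambda>x. N #> x) ` ?D \<subseteq> {N}"
      using DN coset_join2 N.subgroup_axioms by (auto simp: subset_iff)
    then have "card ((\<lambda>x. N #> x) ` ?D) \<le> 1" using card_mono[of "{N}"] by fastforce
    moreover have "card ((\<lambda>x. N #> x) ` ?D) = p"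
      using E derived_quot[OF N] by (simp add: extraspecial_def)
    ultimately show False using p by (auto simp: prime_nat_iff)
  qed
  ultimately show ?thesis by blast
qed

section \<open>Powers of elements and of homomorphisms\<close>

lemma (in group) pow_eq_one_coprime:
  assumes "x \<in> carrier G" "x [^] (m::nat) = \<one>" "coprime m (order G)"
  shows "x = \<one>"
proof -
  have "ord x dvd 1"
    using assms ord_dvd_group_order[OF assms(1)] pow_eq_id[OF assms(1)]
    by (metis coprime_def nat_dvd_1_iff_1)
  then show ?thesis using ord_eq_1[OF assms(1)] by simp
qed

lemma (in group) hom_funpow:
  assumes "f \<in> hom G G"
  shows "f ^^ k \<in> hom G G"
proof (induction k)
  case 0 then show ?case by (simp add: hom_def)
next
  case (Suc k)
  then show ?case
    by (auto intro!: homI simp: hom_in_carrier[OF Suc] hom_mult[OF Suc]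
          hom_in_carrier[OF assms] hom_mult[OF assms])
qed

lemma funpow_id_on:
  assumes "\<And>x. x \<in> A \<Longrightarrow> f x = x" "x \<in> A"
  shows "(f ^^ k) x = x"
  using assms by (induction k) auto

section \<open>Regular orbits of cyclic groups acting on abelian groups\<close>

context comm_group
begin

text \<open>The norm (in additive notation, the trace) of \<open>x\<close> along \<open>f\<close> if \<open>f\<^sup>m\<close> is the identity.\<close>

definition norm_map :: "('a \<Rightarrow> 'a) \<Rightarrow> nat \<Rightarrow> 'a \<Rightarrow> 'a" where
  "norm_map f m x = (\<Otimes>i\<in>{..<m}. (f ^^ i) x)"

context
  fixes f :: "'a \<Rightarrow> 'a"
  assumes f: "f \<in> hom G G"
begin

lemma funpow_closed: "x \<in> carrier G \<Longrightarrow> (f ^^ k) x \<in> carrier G"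
  using hom_funpow[OF f] hom_in_carrier by metis

lemma norm_map_0: "norm_map f 0 x = \<one>"
  by (simp add: norm_map_def)

lemma norm_map_Suc:
  "x \<in> carrier G \<Longrightarrow> norm_map f (Suc m) x = norm_map f m x \<otimes> (f ^^ m) x"
  by (simp add: norm_map_def lessThan_Suc finprod_insert funpow_closed m_comm)

lemma norm_map_hom: "norm_map f m \<in> hom G G"
proof (induction m)
  case 0 then show ?case by (simp add: hom_def norm_map_0 norm_map_def)
next
  case (Suc m)
  have "norm_map f m x \<in> carrier G" if "x \<in> carrier G" for x
    using Suc that hom_in_carrier by metis
  then show ?case
    using hom_mult[OF Suc] hom_mult[OF hom_funpow[OF f, of m]]
    by (auto intro!: homI simp: norm_map_Suc funpow_closed m_ac)
qed

lemma norm_map_commute: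
  assumes h: "h \<in> hom G G" and c: "\<And>x. x \<in> carrier G \<Longrightarrow> h (f x) = f (h x)"
    and x: "x \<in> carrier G"
  shows "h (norm_map f m x) = norm_map f m (h x)"
proof -
  have hx: "h x \<in> carrier G" using h x hom_in_carrier by metis
  have pow: "h ((f ^^ i) x) = (f ^^ i) (h x)" for i
    by (induction i) (auto simp: c funpow_closed x)
  show ?thesis
  proof (induction m)
    case 0 then show ?case by (simp add: norm_map_0 hom_one[OF h] group_axioms)
  next
    case (Suc m)
    have "norm_map f m x \<in> carrier G" using norm_map_hom x hom_in_carrier by metis
    then show ?case using Suc pow x hx
      by (simp add: norm_map_Suc hom_mult[OF h] funpow_closed)
  qed
qed

text \<open>Applying \<open>f\<close> shifts the factors of the norm cyclically, because the factor \<open>f\<^sup>m x\<close> that is gained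
  equals the factor \<open>x\<close> that is lost.\<close>

lemma norm_map_invariant:
  assumes x: "x \<in> carrier G" and m: "(f ^^ m) x = x"
  shows "f (norm_map f m x) = norm_map f m x"
proof -
  have T: "norm_map f k x \<in> carrier G" for k using norm_map_hom x hom_in_carrier by metis
  \<comment> \<open>multiplying by \<open>x\<close>, the lost factor, avoids reindexing the product\<close>
  have "x \<otimes> f (norm_map f k x) = norm_map f (Suc k) x" for k
  proof (induction k)
    case 0 show ?case using x by (simp add: norm_map_0 norm_map_Suc hom_one[OF f] group_axioms)
  next
    case (Suc k)
    have fT: "f (norm_map f k x) \<in> carrier G" "f ((f ^^ k) x) \<in> carrier G"
      using T f hom_in_carrier funpow_closed[OF x] by metis+
    have "x \<otimes> f (norm_map f (Suc k) x) = (x \<otimes> f (norm_map f k x)) \<otimes> (f ^^ Suc k) x"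
      using x T fT by (simp add: norm_map_Suc[of x k] hom_mult[OF f] funpow_closed m_assoc)
    also have "\<dots> = norm_map f (Suc (Suc k)) x"
      unfolding Suc using norm_map_Suc[OF x] by simp
    finally show ?case .
  qed
  from this[of m] have "x \<otimes> f (norm_map f m x) = x \<otimes> norm_map f m x"
    using x T m by (simp add: norm_map_Suc m_comm)
  then show ?thesis using x T f hom_in_carrier by (metis l_cancel)
qed

lemma norm_map_fixed:
  assumes x: "x \<in> carrier G" and "f x = x"
  shows "norm_map f m x = x [^] m"
proof -
  have "(f ^^ i) x = x" for i using assms(2) by (induction i) auto
  then show ?thesis using x by (induction m) (auto simp: norm_map_0 norm_map_Suc)
qed

end

text \<open>Every \<open>w\<close> satisfies \<open>w\<^sup>m = y \<cdot> T(w)\<close>, where the norm \<open>T(w)\<close> is fixed by \<open>f\<close> and \<open>y = w\<^sup>m / T(w)\<close> lies in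
  the kernel of \<open>T\<close>. As taking \<open>m\<close>-th powers is injective, \<open>y\<close> is nontrivial when \<open>f\<close> moves \<open>w\<close>, and a
  fixed point in the kernel of \<open>T\<close> is trivial, since \<open>T\<close> takes it to its \<open>m\<close>-th power.\<close>

lemma exists_nontrivial_in_norm_kernel:
  assumes f: "f \<in> hom G G" and m: "\<And>x. x \<in> carrier G \<Longrightarrow> (f ^^ m) x = x"
    and cop: "coprime m (order G)"
    and w: "w \<in> carrier G" "f w \<noteq> w"
  obtains y where "y \<in> carrier G" "norm_map f m y = \<one>" "f y \<noteq> y"
proof
  let ?T = "norm_map f m"
  define y where "y = w [^] m \<otimes> inv ?T w"
  have T: "?T w \<in> carrier G" using norm_map_hom[OF f] w hom_in_carrier by metis
  interpret T: group_hom G G ?T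
    using norm_map_hom[OF f] by (intro group_hom.intro group_hom_axioms.intro group_axioms)
  interpret f: group_hom G G f
    using f by (intro group_hom.intro group_hom_axioms.intro group_axioms)
  have fT: "f (?T w) = ?T w" using norm_map_invariant[OF f] w m by blast
  show y: "y \<in> carrier G" unfolding y_def using w T by simp
  show Ty: "?T y = \<one>"
    unfolding y_def using w T norm_map_fixed[OF f T fT]
    by (simp add: T.hom_nat_pow r_inv)
  show "f y \<noteq> y"
  proof
    assume fy: "f y = y"
    then have "y [^] m = \<one>" using norm_map_fixed[OF f y] Ty by simp
    then have "y = \<one>" using pow_eq_one_coprime[OF y _ cop] by blast
    then have wm: "w [^] m = ?T w" unfolding y_def using w T
      by (metis inv_inv inv_equality nat_pow_closed inv_closed)
    have "(f w \<otimes> inv w) [^] m = f (w [^] m) \<otimes> inv (w [^] m)"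
      using w by (simp add: pow_mult_distrib m_comm f.hom_nat_pow nat_pow_inv)
    also have "\<dots> = \<one>" unfolding wm using fT T by simp
    finally have "f w \<otimes> inv w = \<one>" using pow_eq_one_coprime[OF _ _ cop] w by simp
    then have "f w = w" using w by (metis f.hom_closed inv_closed inv_equality inv_inv)
    then show False using w by simp
  qed
qed

text \<open>Take \<open>v\<close> with the smallest stabilizer in \<open>\<langle>f\<rangle>\<close>. If some \<open>b \<in> \<langle>f\<rangle>\<close> fixes \<open>v\<close> without being the
  identity, choose \<open>y\<close> in the kernel of the norm of \<open>b\<close> with \<open>b y \<noteq> y\<close>. The fixed points of \<open>b\<close> and the
  kernel of its norm are invariant under the commutative group \<open>\<langle>f\<rangle>\<close> and meet trivially, so
  whatever fixes \<open>v \<cdot> y\<close> fixes both \<open>v\<close> and \<open>y\<close>. The stabilizer of \<open>v \<cdot> y\<close> is then smaller than that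
  of \<open>v\<close>, as \<open>b\<close> no longer belongs to it.\<close>

theorem exists_regular_orbit:
  assumes f: "f \<in> hom G G" and m: "\<And>x. x \<in> carrier G \<Longrightarrow> (f ^^ m) x = x"
    and "0 < m" and cop: "coprime m (order G)"
  obtains v where "v \<in> carrier G"
    "\<And>k x. \<lbrakk>(f ^^ k) v = v; x \<in> carrier G\<rbrakk> \<Longrightarrow> (f ^^ k) x = x"
proof -
  \<comment> \<open>the stabilizer of \<open>v\<close>, as a set of exponents below \<open>m\<close> so that its size can be compared\<close>
  define S where "S v = {k. k < m \<and> (f ^^ k) v = v}" for v
  have finS: "finite (S v)" for v by (simp add: S_def)
  have fmod: "(f ^^ (k mod m)) x = (f ^^ k) x" if x: "x \<in> carrier G" for k x
  proof -
    have "(f ^^ (k mod m + m * (k div m))) x = (f ^^ (k mod m)) (((f ^^ m) ^^ (k div m)) x)"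
      by (simp only: funpow_add funpow_mult mult.commute o_apply)
    also have "((f ^^ m) ^^ (k div m)) x = x"
      using m x by (rule funpow_id_on)
    finally show ?thesis by simp
  qed
  obtain v where v: "v \<in> carrier G" and min: "\<And>u. u \<in> carrier G \<Longrightarrow> card (S v) \<le> card (S u)"
    using ex_has_least_nat[of "\<lambda>v. v \<in> carrier G" \<one> "\<lambda>v. card (S v)"] by auto
  have "(f ^^ k) w = w" if k: "(f ^^ k) v = v" and w: "w \<in> carrier G" for k w
  proof (rule ccontr)
    define b where "b = f ^^ k"
    assume "(f ^^ k) w \<noteq> w"
    then have bw: "b w \<noteq> w" by (simp add: b_def)
    have b: "b \<in> hom G G" unfolding b_def by (rule hom_funpow[OF f])
    have bm: "(b ^^ m) x = x" if "x \<in> carrier G" for x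
    proof -
      have "(b ^^ m) x = ((f ^^ m) ^^ k) x" by (simp add: b_def funpow_mult mult.commute)
      then show ?thesis using m that funpow_id_on[of "carrier G" "f ^^ m"] by metis
    qed
    obtain y where y: "y \<in> carrier G" "norm_map b m y = \<one>" "b y \<noteq> y"
      using exists_nontrivial_in_norm_kernel[OF b bm cop w bw] by blast
    interpret T: group_hom G G "norm_map b m"
      using norm_map_hom[OF b] by (intro group_hom.intro group_hom_axioms.intro group_axioms)
    interpret b: group_hom G G b
      using b by (intro group_hom.intro group_hom_axioms.intro group_axioms)
    let ?u = "v \<otimes> y"
    have stab: "(f ^^ j) v = v \<and> (f ^^ j) y = y" if j: "(f ^^ j) ?u = ?u" for j
    proof -
      interpret g: group_hom G G "f ^^ j"
        using hom_funpow[OF f] by (intro group_hom.intro group_hom_axioms.intro group_axioms)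
      have comm: "(f ^^ j) (b x) = b ((f ^^ j) x)" for x
        unfolding b_def by (metis add.commute funpow_add o_apply)
      \<comment> \<open>\<open>d\<close> lies both among the fixed points of \<open>b\<close> and in the kernel of its norm\<close>
      define d where "d = inv v \<otimes> (f ^^ j) v"
      have d: "d \<in> carrier G" using v by (simp add: d_def)
      have uj: "(f ^^ j) v \<otimes> (f ^^ j) y = v \<otimes> y" using j v y by simp
      have d': "d = y \<otimes> inv ((f ^^ j) y)"
      proof -
        have "d \<otimes> (f ^^ j) y = inv v \<otimes> ((f ^^ j) v \<otimes> (f ^^ j) y)"
          using v y by (simp add: d_def m_assoc)
        also have "\<dots> = y" unfolding uj using v y by (simp add: inv_solve_left')
        finally show ?thesis using d y by (metis g.hom_closed inv_solve_right)
      qed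
      have "b d = d"
        using k v comm[of v, symmetric] by (simp add: d_def) (simp add: b_def)
      then have "norm_map b m d = d [^] m" using norm_map_fixed[OF b d] by blast
      moreover have "norm_map b m d = \<one>"
        unfolding d' using y norm_map_commute[OF b hom_funpow[OF f, of j] comm y(1), of m] by simp
      ultimately have "d = \<one>" using pow_eq_one_coprime[OF d _ cop] by simp
      then show ?thesis using d' v y unfolding d_def
        by (metis g.hom_closed inv_closed inv_equality inv_inv)
    qed
    have "S ?u \<subseteq> S v" using stab by (auto simp: S_def)
    moreover have "k mod m \<in> S v" using k v \<open>0 < m\<close> fmod by (simp add: S_def)
    moreover have "k mod m \<notin> S ?u"
      using stab[of "k mod m"] y fmod by (auto simp: S_def b_def)
    ultimately have "S ?u \<subset> S v" by blast
    then have "card (S ?u) < card (S v)" using finS psubset_card_mono by blast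
    then show False using min[of ?u] v y by simp
  qed
  then show ?thesis using that v by blast
qed

end

section \<open>Automorphisms acting trivially modulo the center\<close>

text \<open>If \<open>f\<close> changes \<open>x\<close> and \<open>y\<close> only by central factors, these cancel in the commutator of \<open>f x\<close> and \<open>f y\<close>.\<close>

lemma (in group) hom_fixes_derived:
  assumes f: "f \<in> hom G G" and cen: "\<And>x. x \<in> carrier G \<Longrightarrow> f x \<otimes> inv x \<in> center G"
    and d: "d \<in> derived G (carrier G)"
  shows "f d = d"
proof -
  interpret f: group_hom G G f
    using f by (intro group_hom.intro group_hom_axioms.intro group_axioms)
  let ?F = "{x \<in> carrier G. f x = x}"
  have F: "subgroup ?F G" by (rule subgroupI) (auto intro: exI[of _ \<one>])
  have "derived_set G (carrier G) \<subseteq> ?F"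
  proof clarsimp
    fix x y assume xy: "x \<in> carrier G" "y \<in> carrier G"
    define a b where "a = f x \<otimes> inv x" and "b = f y \<otimes> inv y"
    have a: "a \<in> carrier G" "\<And>g. g \<in> carrier G \<Longrightarrow> a \<otimes> g = g \<otimes> a"
      and b: "b \<in> carrier G" "\<And>g. g \<in> carrier G \<Longrightarrow> b \<otimes> g = g \<otimes> b"
      using cen[OF xy(1)] cen[OF xy(2)] by (auto simp: a_def b_def center_def)
    have fx: "f x = x \<otimes> a" and fy: "f y = y \<otimes> b"
      using xy a(2)[OF xy(1), symmetric] b(2)[OF xy(2), symmetric]
      by (simp_all add: a_def b_def m_assoc)
    have exchange: "(u \<otimes> c) \<otimes> (v \<otimes> d) = (u \<otimes> v) \<otimes> (c \<otimes> d)"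
      if "u \<in> carrier G" "v \<in> carrier G" "c \<in> carrier G" "d \<in> carrier G" "c \<otimes> v = v \<otimes> c"
      for u v c d
    proof -
      have "(u \<otimes> c) \<otimes> (v \<otimes> d) = u \<otimes> (c \<otimes> v) \<otimes> d"
        using that(1-4) by (simp add: m_assoc)
      also have "\<dots> = (u \<otimes> v) \<otimes> (c \<otimes> d)"
        unfolding that(5) using that(1-4) by (simp add: m_assoc)
      finally show ?thesis .
    qed
    have cancel: "(u \<otimes> c) \<otimes> inv (v \<otimes> c) = u \<otimes> inv v"
      if "u \<in> carrier G" "v \<in> carrier G" "c \<in> carrier G" for u v c
    proof -
      have "(u \<otimes> c) \<otimes> inv (v \<otimes> c) = u \<otimes> (c \<otimes> inv c) \<otimes> inv v"
        using that by (simp add: inv_mult_group m_assoc del: r_inv Units_r_inv)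
      then show ?thesis using that by simp
    qed
    have "f x \<otimes> f y = (x \<otimes> y) \<otimes> (a \<otimes> b)"
      unfolding fx fy by (intro exchange xy a b)
    moreover have "inv (f x) \<otimes> inv (f y) = inv ((y \<otimes> x) \<otimes> (a \<otimes> b))"
    proof -
      have "f y \<otimes> f x = (y \<otimes> x) \<otimes> (b \<otimes> a)"
        unfolding fx fy by (intro exchange xy a b)
      also have "b \<otimes> a = a \<otimes> b" by (rule b(2)[OF a(1)])
      finally show ?thesis using xy by (simp flip: inv_mult_group)
    qed
    ultimately have "f x \<otimes> f y \<otimes> inv (f x) \<otimes> inv (f y)
        = (x \<otimes> y) \<otimes> (a \<otimes> b) \<otimes> inv ((y \<otimes> x) \<otimes> (a \<otimes> b))"
      using xy a(1) b(1) by (simp add: m_assoc[of "x \<otimes> y \<otimes> (a \<otimes> b)"])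
    also have "\<dots> = (x \<otimes> y) \<otimes> inv (y \<otimes> x)"
      by (intro cancel m_closed xy a b)
    also have "\<dots> = x \<otimes> y \<otimes> inv x \<otimes> inv y"
      using xy by (simp add: inv_mult_group m_assoc)
    finally show "f x \<otimes> f y \<otimes> inv (f x) \<otimes> inv (f y) = x \<otimes> y \<otimes> inv x \<otimes> inv y" .
  qed
  then have "derived G (carrier G) \<subseteq> ?F"
    unfolding derived_def by (rule generate_subgroup_incl[OF _ F])
  then show ?thesis using d by blast
qed

text \<open>The central element \<open>z = f(x) x\<^sup>-\<^sup>1\<close> is fixed by \<open>f\<close>, since it lies in the derived subgroup.
  Therefore \<open>f\<^sup>k(x) = z\<^sup>k x\<close> for all \<open>k\<close>, and \<open>k = m\<close> forces \<open>z\<^sup>m = \<one>\<close>, so \<open>z = \<one>\<close> by coprimality.\<close>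

lemma (in group) coprime_hom_trivial_mod_center:
  assumes f: "f \<in> hom G G" and cen: "\<And>x. x \<in> carrier G \<Longrightarrow> f x \<otimes> inv x \<in> center G"
    and der: "center G \<subseteq> derived G (carrier G)"
    and m: "\<And>x. x \<in> carrier G \<Longrightarrow> (f ^^ m) x = x" and cop: "coprime m (order G)"
    and x: "x \<in> carrier G"
  shows "f x = x"
proof -
  define z where "z = f x \<otimes> inv x"
  have zc: "z \<in> center G" using cen[OF x] by (simp add: z_def)
  then have z: "z \<in> carrier G" "f z = z"
    using hom_fixes_derived[OF f cen] der by (auto simp: center_def)
  have fx: "f x = z \<otimes> x" using x f hom_in_carrier[OF f x] by (simp add: z_def m_assoc)
  have "(f ^^ k) x = z [^] k \<otimes> x" for k
  proof (induction k)
    case (Suc k)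
    have "f (z [^] k) = z [^] k"
      using z group_hom.hom_nat_pow[of G G f z k] f
      by (simp add: group_hom_def group_hom_axioms_def group_axioms)
    then show ?case using Suc x z by (simp add: hom_mult[OF f] fx m_assoc)
  qed (use x in simp)
  then have "z [^] m \<otimes> x = x" using m[OF x] by metis
  then have "z [^] m = \<one>" using x z by (metis l_one nat_pow_closed one_closed r_cancel)
  then show ?thesis using pow_eq_one_coprime[OF z(1) _ cop] fx x by simp
qed

section \<open>Automorphisms acting on the cosets of the center\<close>

context group
begin

lemma auto_bij_betw: "f \<in> auto G \<Longrightarrow> bij_betw f (carrier G) (carrier G)"
  by (simp add: auto_def Bij_def)

lemma auto_hom: "f \<in> auto G \<Longrightarrow> f \<in> hom G G"
  by (simp add: auto_def)

lemma carrier_AutoGroup: "carrier (AutoGroup G) = auto G"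
  by (simp add: AutoGroup_def)

lemma AutoGroup_mult_apply:
  assumes "f \<in> auto G" "g \<in> auto G" "x \<in> carrier G"
  shows "(f \<otimes>\<^bsub>AutoGroup G\<^esub> g) x = f (g x)"
  using assms by (simp add: AutoGroup_def BijGroup_def auto_def compose_eq)

lemma AutoGroup_pow_apply:
  assumes f: "f \<in> auto G" and x: "x \<in> carrier G"
  shows "(f [^]\<^bsub>AutoGroup G\<^esub> k) x = (f ^^ k) x"
  using x
proof (induction k arbitrary: x)
  case 0
  then show ?case by (simp add: AutoGroup_def BijGroup_def nat_pow_def)
next
  case (Suc k)
  interpret A: group "AutoGroup G" by (rule AutoGroup)
  have "f [^]\<^bsub>AutoGroup G\<^esub> k \<in> auto G"
    using f A.nat_pow_closed by (simp add: carrier_AutoGroup)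
  moreover have "f x \<in> carrier G" using auto_hom[OF f] Suc.prems by (rule hom_in_carrier)
  ultimately show ?case
    using Suc f by (simp add: AutoGroup_mult_apply funpow_swap1)
qed

lemma auto_image_center:
  assumes f: "f \<in> auto G"
  shows "f ` center G = center G"
proof -
  note h = auto_hom[OF f]
  have surj: "f ` carrier G = carrier G" and inj: "inj_on f (carrier G)"
    using auto_bij_betw[OF f] by (auto simp: bij_betw_def)
  have iff: "f z \<in> center G \<longleftrightarrow> z \<in> center G" if z: "z \<in> carrier G" for z
  proof -
    have "f z \<in> center G \<longleftrightarrow> (\<forall>g\<in>f ` carrier G. f z \<otimes> g = g \<otimes> f z)"
      using hom_in_carrier[OF h z] by (simp add: center_def surj)
    also have "\<dots> \<longleftrightarrow> (\<forall>g\<in>carrier G. f (z \<otimes> g) = f (g \<otimes> z))"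
      using z by (auto simp: hom_mult[OF h])
    also have "\<dots> \<longleftrightarrow> z \<in> center G"
      using z inj by (auto simp: center_def inj_on_eq_iff)
    finally show ?thesis .
  qed
  have "center G \<subseteq> carrier G" by (auto simp: center_def)
  show ?thesis
  proof
    show "f ` center G \<subseteq> center G" using iff \<open>center G \<subseteq> carrier G\<close> by blast
    show "center G \<subseteq> f ` center G"
    proof
      fix z assume z: "z \<in> center G"
      then obtain y where "y \<in> carrier G" "z = f y"
        using surj \<open>center G \<subseteq> carrier G\<close> by blast
      then show "z \<in> f ` center G" using iff z by blast
    qed
  qed
qed

lemma auto_image_coset:
  assumes f: "f \<in> auto G" and x: "x \<in> carrier G"
  shows "f ` (center G #> x) = center G #> f x"
proof -
  have "f ` (center G #> x) = (\<lambda>z. f (z \<otimes> x)) ` center G"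
    by (auto simp: r_coset_def)
  also have "\<dots> = (\<lambda>z. f z \<otimes> f x) ` center G"
    using x by (intro image_cong hom_mult[OF auto_hom[OF f]]) (simp_all add: center_def)
  also have "\<dots> = (\<lambda>z. z \<otimes> f x) ` (f ` center G)"
    by (simp add: image_image)
  also have "\<dots> = center G #> f x"
    unfolding auto_image_center[OF f] by (auto simp: r_coset_def)
  finally show ?thesis .
qed

lemma auto_image_hom_FactGroup:
  assumes f: "f \<in> auto G"
  shows "(`) f \<in> hom (G Mod center G) (G Mod center G)"
proof (rule homI)
  fix A assume A: "A \<in> carrier (G Mod center G)"
  then show "f ` A \<in> carrier (G Mod center G)"
    using auto_hom[OF f] by (auto simp: carrier_FactGroup auto_image_coset[OF f] hom_in_carrier)
  fix B assume "B \<in> carrier (G Mod center G)"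
  with A have "A \<subseteq> carrier G" "B \<subseteq> carrier G"
    by (auto simp: carrier_FactGroup r_coset_def center_def)
  then show "f ` (A \<otimes>\<^bsub>G Mod center G\<^esub> B) = f ` A \<otimes>\<^bsub>G Mod center G\<^esub> f ` B"
    using set_mult_hom[OF auto_hom[OF f]] by simp
qed

lemma auto_image_nontrivial_coset:
  assumes f: "f \<in> auto G" and C: "C \<in> nontrivial_central_cosets G"
  shows "f ` C \<in> nontrivial_central_cosets G"
proof -
  have C': "C \<in> carrier (G Mod center G)" "C \<noteq> center G"
    using C by (auto simp: nontrivial_central_cosets_def)
  then have "C \<subseteq> carrier G"
    by (auto simp: carrier_FactGroup r_coset_def center_def)
  moreover have "center G \<subseteq> carrier G" by (auto simp: center_def)
  ultimately have "f ` C \<noteq> f ` center G"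
    using C'(2) auto_bij_betw[OF f] by (metis bij_betw_def inj_on_image_eq_iff)
  then show ?thesis
    using hom_in_carrier[OF auto_image_hom_FactGroup[OF f] C'(1)]
    by (simp add: nontrivial_central_cosets_def auto_image_center[OF f])
qed

text \<open>Being a transitive action includes being an action at all; this part holds for any group of
  automorphisms, because automorphisms preserve the center.\<close>

lemma group_action_central_cosets:
  assumes "subgroup A (AutoGroup G)"
  shows "group_action (AutoGroup G\<lparr>carrier := A\<rparr>) (nontrivial_central_cosets G)
           (\<lambda>f. \<lambda>C\<in>nontrivial_central_cosets G. f ` C)"
proof -
  have A: "A \<subseteq> auto G" using subgroup.subset[OF assms] by (simp add: carrier_AutoGroup)
  have sub: "C \<subseteq> carrier G" if "C \<in> nontrivial_central_cosets G" for C
    using that by (auto simp: nontrivial_central_cosets_def carrier_FactGroup r_coset_def center_def)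
  show ?thesis
  proof (rule group_actionI)
    show "group (AutoGroup G\<lparr>carrier := A\<rparr>)"
      using group.subgroup_imp_group[OF AutoGroup assms] .
  next
    fix C assume C: "C \<in> nontrivial_central_cosets G"
    show "(\<lambda>C\<in>nontrivial_central_cosets G. \<one>\<^bsub>AutoGroup G\<lparr>carrier := A\<rparr>\<^esub> ` C) C = C"
      using C sub[OF C] by (force simp: AutoGroup_def BijGroup_def)
    fix f assume f: "f \<in> carrier (AutoGroup G\<lparr>carrier := A\<rparr>)"
    show "(\<lambda>C\<in>nontrivial_central_cosets G. f ` C) C \<in> nontrivial_central_cosets G"
      using C f A auto_image_nontrivial_coset by auto
    fix g assume g: "g \<in> carrier (AutoGroup G\<lparr>carrier := A\<rparr>)"
    have "(f \<otimes>\<^bsub>AutoGroup G\<^esub> g) ` C = f ` g ` C"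
    proof -
      have "(f \<otimes>\<^bsub>AutoGroup G\<^esub> g) x = f (g x)" if "x \<in> C" for x
        using f g A sub[OF C] that by (intro AutoGroup_mult_apply) auto
      then show ?thesis by (simp add: image_image)
    qed
    then show "(\<lambda>C\<in>nontrivial_central_cosets G. (f \<otimes>\<^bsub>AutoGroup G\<lparr>carrier := A\<rparr>\<^esub> g) ` C) C =
        (\<lambda>C\<in>nontrivial_central_cosets G. f ` C) ((\<lambda>C\<in>nontrivial_central_cosets G. g ` C) C)"
      using C g A auto_image_nontrivial_coset by auto
  qed auto
qed

end

lemma image_funpow:
  fixes f :: "'a \<Rightarrow> 'a"
  shows "((`) f ^^ k) A = (f ^^ k) ` A"
  by (induction k) (simp_all add: image_comp)

lemma card_nontrivial_central_cosets:
  fixes G (structure)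
  assumes "group G"
  shows "card (nontrivial_central_cosets G) = card (rcosets\<^bsub>G\<^esub> (center G)) - 1"
proof -
  interpret group G by fact
  have "center G \<in> rcosets (center G)"
    using subgroup.subgroup_in_rcosets[OF center_subgroup group_axioms] .
  then show ?thesis
    by (simp add: nontrivial_central_cosets_def FactGroup_def)
qed

text \<open>An abelian group has trivial derived subgroup, so an abelian semi-extraspecial group, in which the
  derived subgroup is the center, would be trivial.\<close>

lemma nontrivial_central_cosets_ne:
  fixes G (structure)
  assumes p: "Factorial_Ring.prime p" and G: "semi_extraspecial p G"
  shows "nontrivial_central_cosets G \<noteq> {}"
proof
  interpret group G using G by (simp add: semi_extraspecial_def p_group_def)
  assume "nontrivial_central_cosets G = {}"
  then have all: "center G #> x = center G" if "x \<in> carrier G" for x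
    using that by (auto simp: nontrivial_central_cosets_def carrier_FactGroup)
  have "carrier G \<subseteq> center G"
    using all rcos_self[OF _ center_subgroup] by blast
  then have comm: "x \<otimes> y = y \<otimes> x" if "x \<in> carrier G" "y \<in> carrier G" for x y
    using that by (auto simp: center_def)
  interpret comm_group G by (rule group_comm_groupI) (rule comm)
  have "carrier G = {\<one>}"
    using semi_extraspecial_derived_eq_center[OF p G] derived_eq_singleton[of "carrier G"]
      \<open>carrier G \<subseteq> center G\<close> subgroup.subset[OF center_subgroup] by auto
  then show False using G by (simp add: semi_extraspecial_def)
qed

text \<open>The regular orbit on the abelian group \<open>G/Z\<close> yields a coset such that every power of \<open>\<phi>\<close> fixing it
  acts trivially on \<open>G/Z\<close>, and then, by faithfulness, on \<open>G\<close>.\<close>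

lemma p'_automorphism_regular_coset:
  fixes G (structure)
  assumes p: "Factorial_Ring.prime p" and G: "semi_extraspecial p G"
    and \<phi>: "p'_automorphism p G \<phi>"
  obtains C where "C \<in> nontrivial_central_cosets G"
    "\<And>k. (\<phi> ^^ k) ` C = C \<Longrightarrow> group.ord (AutoGroup G) \<phi> dvd k"
proof -
  interpret group G using G by (simp add: semi_extraspecial_def p_group_def)
  interpret A: group "AutoGroup G" by (rule AutoGroup)
  obtain n where n: "order G = p ^ n"
    using G by (auto simp: semi_extraspecial_def p_group_def)
  let ?Z = "center G" and ?Q = "G Mod center G"
  define m where "m = A.ord \<phi>"
  have \<phi>a: "\<phi> \<in> auto G" and pm: "\<not> p dvd m" 
    using \<phi> by (auto simp: p'_automorphism_def m_def)
  have \<phi>A: "\<phi> \<in> carrier (AutoGroup G)" using \<phi>a by (simp add: carrier_AutoGroup)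
  have "0 < m" using pm by (auto intro: ccontr)
  have cop: "coprime m (order G)"
    unfolding n using p pm by (metis coprime_commute coprime_power_right_iff prime_imp_coprime_nat)
  have dvd: "m dvd k \<longleftrightarrow> (\<forall>x\<in>carrier G. (\<phi> ^^ k) x = x)" for k
  proof -
    have "m dvd k \<longleftrightarrow> \<phi> [^]\<^bsub>AutoGroup G\<^esub> k = \<one>\<^bsub>AutoGroup G\<^esub>"
      using A.pow_eq_id[OF \<phi>A] by (simp add: m_def)
    also have "\<dots> \<longleftrightarrow> (\<forall>x\<in>carrier G. (\<phi> [^]\<^bsub>AutoGroup G\<^esub> k) x = \<one>\<^bsub>AutoGroup G\<^esub> x)"
    proof -
      have "g \<in> extensional (carrier G)" if "g \<in> carrier (AutoGroup G)" for g
        using that by (simp add: carrier_AutoGroup auto_def Bij_def)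
      then show ?thesis
        using A.nat_pow_closed[OF \<phi>A] A.one_closed by (metis extensionalityI)
    qed
    also have "\<dots> \<longleftrightarrow> (\<forall>x\<in>carrier G. (\<phi> ^^ k) x = x)"
      using AutoGroup_pow_apply[OF \<phi>a] by (simp add: AutoGroup_def BijGroup_def)
    finally show ?thesis .
  qed
  have der: "derived G (carrier G) = ?Z" by (rule semi_extraspecial_derived_eq_center[OF p G])
  interpret Q: comm_group ?Q using derived_quot_is_comm_group by (simp add: der)
  have ordQ: "order ?Q dvd order G"
    using lagrange[OF center_subgroup] by (simp add: order_def FactGroup_def) (metis dvd_triv_left)
  have copQ: "coprime m (order ?Q)" by (rule coprime_divisors[OF dvd_refl ordQ cop])
  have subG: "C \<subseteq> carrier G" if "C \<in> carrier ?Q" for C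
    using that by (auto simp: carrier_FactGroup r_coset_def center_def)
  have \<phi>m: "((`) \<phi> ^^ m) C = C" if "C \<in> carrier ?Q" for C
    unfolding image_funpow using dvd[of m] subG[OF that] by force
  obtain C where C: "C \<in> carrier ?Q"
    and reg: "\<And>k D. \<lbrakk>((`) \<phi> ^^ k) C = C; D \<in> carrier ?Q\<rbrakk> \<Longrightarrow> ((`) \<phi> ^^ k) D = D"
    using Q.exists_regular_orbit[OF auto_image_hom_FactGroup[OF \<phi>a] \<phi>m \<open>0 < m\<close> copQ] by blast
  have faithful: "m dvd k" if k: "\<And>D. D \<in> carrier ?Q \<Longrightarrow> (\<phi> ^^ k) ` D = D" for k
  proof -
    have "(\<phi> ^^ k) x = x" if x: "x \<in> carrier G" for x
    proof (rule coprime_hom_trivial_mod_center[of "\<phi> ^^ k" m])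
      show hk: "\<phi> ^^ k \<in> hom G G" using hom_funpow auto_hom[OF \<phi>a] by blast
      show "(\<phi> ^^ k) y \<otimes> inv y \<in> ?Z" if y: "y \<in> carrier G" for y
      proof -
        have "(\<phi> ^^ k) y \<in> (\<phi> ^^ k) ` (?Z #> y)"
          using rcos_self[OF y center_subgroup] by blast
        also have "\<dots> = ?Z #> y" using k y by (auto simp: carrier_FactGroup)
        finally show ?thesis
          using y center_subgroup subgroup.rcos_module_imp by (metis group_axioms)
      qed
      show "?Z \<subseteq> derived G (carrier G)" using der by simp
      show "((\<phi> ^^ k) ^^ m) y = y" if "y \<in> carrier G" for y
        using dvd[of "k * m"] that by (simp add: funpow_mult)
    qed (use cop x in auto)
    then show ?thesis using dvd by blast
  qed
  have regC: "m dvd k" if "(\<phi> ^^ k) ` C = C" for k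
    using faithful reg that by (simp add: image_funpow)
  show ?thesis
  proof (cases "C = ?Z")
    case True
    \<comment> \<open>every automorphism fixes the coset \<open>Z\<close>, so \<open>\<phi>\<close> is the identity and any coset is regular\<close>
    have "\<phi> ` C = C" using auto_image_center[OF \<phi>a] True by simp
    then have "m = 1" using regC[of 1] by simp
    moreover obtain D where "D \<in> nontrivial_central_cosets G"
      using nontrivial_central_cosets_ne[OF p G] by blast
    ultimately show ?thesis using that by (simp add: m_def)
  next
    case False
    then have "C \<in> nontrivial_central_cosets G" using C by (simp add: nontrivial_central_cosets_def)
    then show ?thesis using that regC by (simp add: m_def)
  qed
qed

theorem corollary3p2:
  fixes p a :: nat and G :: "('a, 'b) monoid_scheme"
  assumes "Factorial_Ring.prime p"
    and "semi_extraspecial p G"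
    and "card (rcosets\<^bsub>G\<^esub> (center G)) = p ^ (2 * a)"
  shows "\<forall>\<phi>. p'_automorphism p G \<phi> \<longrightarrow>
           group.ord (AutoGroup G) \<phi> \<le> p ^ (2 * a) - 1 \<and>
           (group.ord (AutoGroup G) \<phi> = p ^ (2 * a) - 1 \<longleftrightarrow>
              permutes_cosets_transitively G \<phi>)"
proof (intro allI impI)
  fix \<phi> assume \<phi>: "p'_automorphism p G \<phi>"
  interpret group G using assms(2) by (simp add: semi_extraspecial_def p_group_def)
  interpret A: group "AutoGroup G" by (rule AutoGroup)
  let ?X = "nontrivial_central_cosets G" and ?act = "\<lambda>\<psi>. \<lambda>C\<in>nontrivial_central_cosets G. \<psi> ` C"
    and ?S = "subgroup_generated (AutoGroup G) {\<phi>}"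
  define m where "m = A.ord \<phi>"
  have \<phi>a: "\<phi> \<in> auto G" and pm: "\<not> p dvd m"
    using \<phi> by (auto simp: p'_automorphism_def m_def)
  have \<phi>A: "\<phi> \<in> carrier (AutoGroup G)" using \<phi>a by (simp add: carrier_AutoGroup)
  have "0 < m" using pm by (auto intro: ccontr)
  have finX: "finite ?X"
    using assms(2) by (auto simp: nontrivial_central_cosets_def carrier_FactGroup
        semi_extraspecial_def p_group_def)
  have cardX: "card ?X = p ^ (2 * a) - 1"
    using card_nontrivial_central_cosets[OF group_axioms] assms(3) by simp
  have subG: "C \<subseteq> carrier G" if "C \<in> ?X" for C
    using that by (auto simp: nontrivial_central_cosets_def carrier_FactGroup r_coset_def center_def)
  obtain C where C: "C \<in> ?X" and reg: "\<And>k. (\<phi> ^^ k) ` C = C \<Longrightarrow> m dvd k"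
    using p'_automorphism_regular_coset[OF assms(1,2) \<phi>] unfolding m_def by blast
  have pow: "(\<phi> [^]\<^bsub>AutoGroup G\<^esub> k) ` D = (\<phi> ^^ k) ` D" if "D \<in> ?X" for k D
    using subG[OF that] AutoGroup_pow_apply[OF \<phi>a] by (intro image_cong) auto
  have powX: "(\<phi> ^^ k) ` D \<in> ?X" if D: "D \<in> ?X" for k D
    using auto_image_nontrivial_coset[OF _ D] A.nat_pow_closed[OF \<phi>A] pow[OF D]
    by (metis carrier_AutoGroup)
  have powmod: "(\<phi> ^^ k) ` C = (\<phi> ^^ (k mod m)) ` C" for k
  proof -
    have "\<phi> [^]\<^bsub>AutoGroup G\<^esub> (m * (k div m)) = \<one>\<^bsub>AutoGroup G\<^esub>"
      using A.pow_eq_id[OF \<phi>A] by (simp add: m_def)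
    then have "\<phi> [^]\<^bsub>AutoGroup G\<^esub> (m * (k div m) + k mod m) = \<phi> [^]\<^bsub>AutoGroup G\<^esub> (k mod m)"
      using A.nat_pow_mult[OF \<phi>A, of "m * (k div m)" "k mod m"] A.nat_pow_closed[OF \<phi>A] by simp
    then show ?thesis using pow[OF C, of k] pow[OF C, of "k mod m"] by simp
  qed
  have comp: "(\<phi> ^^ i) ` (\<phi> ^^ j) ` D = (\<phi> ^^ (i + j)) ` D" for i j D
    by (simp add: funpow_add image_comp)
  define Orb where "Orb = (\<lambda>k. (\<phi> ^^ k) ` C) ` {..<m}"
  have Orb_sub: "Orb \<subseteq> ?X" using powX[OF C] by (auto simp: Orb_def)
  have inj: "inj_on (\<lambda>k. (\<phi> ^^ k) ` C) {..<m}"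
  proof (rule linorder_inj_onI)
    fix i j assume ij: "i < j" "i \<in> {..<m}" "j \<in> {..<m}"
    show "(\<phi> ^^ i) ` C \<noteq> (\<phi> ^^ j) ` C"
    proof
      assume "(\<phi> ^^ i) ` C = (\<phi> ^^ j) ` C"
      then have "(\<phi> ^^ (m - i)) ` (\<phi> ^^ i) ` C = (\<phi> ^^ (m - i)) ` (\<phi> ^^ j) ` C" by simp
      then have "(\<phi> ^^ m) ` C = (\<phi> ^^ (m + (j - i))) ` C"
        using ij by (simp add: comp)
      then have "(\<phi> ^^ (j - i)) ` C = C"
        using powmod[of m] powmod[of "m + (j - i)"] powmod[of "j - i"] by simp
      from reg[OF this] show False using ij by (auto dest: dvd_imp_le)
    qed
  qed auto
  have cardOrb: "card Orb = m" unfolding Orb_def using card_image[OF inj] by simp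
  have "m \<le> p ^ (2 * a) - 1" using card_mono[OF finX Orb_sub] cardOrb cardX by simp
  moreover have "m = p ^ (2 * a) - 1 \<longleftrightarrow> Orb = ?X"
    using card_subset_eq[OF finX Orb_sub] cardOrb cardX by auto
  moreover have carS: "carrier ?S = {\<phi> [^]\<^bsub>AutoGroup G\<^esub> k |k. k \<in> (UNIV :: nat set)}"
    using A.generate_pow_nat[OF \<phi>A] \<open>0 < m\<close> \<phi>A by (simp add: carrier_subgroup_generated m_def)
  moreover have "Orb = ?X \<longleftrightarrow> permutes_cosets_transitively G \<phi>"
  proof
    assume Orb: "Orb = ?X"
    have "group_action ?S ?X ?act"
      using group_action_central_cosets[OF A.generate_is_subgroup[of "carrier (AutoGroup G) \<inter> {\<phi>}"]]
      by (simp add: subgroup_generated_def)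
    moreover have "\<exists>g\<in>carrier ?S. ?act g x = y" if x: "x \<in> ?X" and y: "y \<in> ?X" for x y
    proof -
      have "x \<in> Orb" "y \<in> Orb" using x y by (simp_all only: Orb)
      then obtain i j where ij: "i < m" "x = (\<phi> ^^ i) ` C" "y = (\<phi> ^^ j) ` C"
        unfolding Orb_def by (elim imageE) simp
      \<comment> \<open>\<open>m - i\<close> steps lead from \<open>x\<close> back to \<open>C\<close>, and \<open>j\<close> further steps to \<open>y\<close>\<close>
      let ?g = "\<phi> [^]\<^bsub>AutoGroup G\<^esub> (j + (m - i))"
      have "?act ?g x = (\<phi> ^^ (j + (m - i))) ` (\<phi> ^^ i) ` C"
        using x pow[OF x] ij by simp
      also have "\<dots> = (\<phi> ^^ (j + m)) ` C"
        using ij(1) by (simp add: comp)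
      also have "\<dots> = y" using powmod[of "j + m"] powmod[of j] ij by simp
      finally show ?thesis using carS by blast
    qed
    ultimately show "permutes_cosets_transitively G \<phi>"
      unfolding permutes_cosets_transitively_def
      by (intro transitive_action.intro transitive_action_axioms.intro)
  next
    assume "permutes_cosets_transitively G \<phi>"
    then interpret T: transitive_action ?S ?X ?act
      by (simp add: permutes_cosets_transitively_def)
    have "?X \<subseteq> Orb"
    proof
      fix y assume "y \<in> ?X"
      then obtain g where "g \<in> carrier ?S" "?act g C = y" using T.unique_orbit[OF C] by blast
      then obtain k :: nat where "y = (\<phi> [^]\<^bsub>AutoGroup G\<^esub> k) ` C" using carS C by auto
      then have "y = (\<phi> ^^ (k mod m)) ` C" using pow[OF C] powmod by simp
      then show "y \<in> Orb" using \<open>0 < m\<close> by (auto simp: Orb_def)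
    qed
    then show "Orb = ?X" using Orb_sub by blast
  qed
  ultimately show "A.ord \<phi> \<le> p ^ (2 * a) - 1 \<and>
      (A.ord \<phi> = p ^ (2 * a) - 1 \<longleftrightarrow> permutes_cosets_transitively G \<phi>)"
    by (simp add: m_def)
qed

end
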